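(* The simple minor relation $\preceq$ between hypergraphs is a quasi-order (i.e. it is reflexive and transitive).
   Context: A hypergraph is a pair $\mathcal{H}=(V,\mathcal{E})$ with $V$ a finite nonempty set and $\mathcal{E}$ a set of subsets of $V$ (the empty set is allowed as a hyperedge). A map $h':V'\to V$ is a quotient map from $\mathcal{H}'=(V',\mathcal{E}')$ to $\mathcal{H}=(V,\mathcal{E})$ if for every $E\subseteq V$: $E\in\mathcal{E}$ if and only if the number of $E'\in\mathcal{E}'$ with $h'(E')=E$ (image set) is odd. $\mathcal{H}$ is a simple minor of $\mathcal{H}'$, written $\mathcal{H}\preceq\mathcal{H}'$, if there is a quotient map from $\mathcal{H}'$ to $\mathcal{H}$. *)

theory Defs
  imports "HOL-Library.FuncSet"
begin

text \<open>
  A hypergraph is a pair of a vertex set and a hyperedge set. The type admits arbitrary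
  pairs; the conditions on them are collected in \<open>is_hypergraph\<close>.
\<close>

type_synonym 'v hypergraph = "'v set \<times> 'v set set"

abbreviation verts :: "'v hypergraph \<Rightarrow> 'v set" where
  "verts H \<equiv> fst H"

abbreviation hedges :: "'v hypergraph \<Rightarrow> 'v set set" where
  "hedges H \<equiv> snd H"

definition is_hypergraph :: "'v hypergraph \<Rightarrow> bool" where
  "is_hypergraph H \<longleftrightarrow> finite (verts H) \<and> verts H \<noteq> {} \<and> hedges H \<subseteq> Pow (verts H)"

text \<open>
  Only the values of \<open>h\<close> on the vertices of \<open>H'\<close> matter. Surjectivity onto the vertices
  of \<open>H\<close> is not required.
\<close>

definition quotient_map :: "('w \<Rightarrow> 'v) \<Rightarrow> 'w hypergraph \<Rightarrow> 'v hypergraph \<Rightarrow> bool" where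
  "quotient_map h H' H \<longleftrightarrow>
     h \<in> verts H' \<rightarrow> verts H \<and>
     (\<forall>E \<subseteq> verts H. E \<in> hedges H \<longleftrightarrow> odd (card {E' \<in> hedges H'. h ` E' = E}))"

text \<open>The two hypergraphs may have vertices of different types.\<close>

definition simple_minor :: "'v hypergraph \<Rightarrow> 'w hypergraph \<Rightarrow> bool" (infix "\<preceq>" 50) where
  "H \<preceq> H' \<longleftrightarrow> (\<exists>h. quotient_map h H' H)"

end

theory Submission
  imports Defs
begin

text \<open>
  For transitivity, compose the quotient maps: grouping the hyperedges of the finest hypergraph
  by their image in the middle one, only the fibres of odd size contribute to the parity, and
  these are exactly the fibres over hyperedges of the middle hypergraph.
\<close>

text \<open>The identity is a quotient map: the only candidate with image \<open>E\<close> is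
  \<open>E\<close> itself, so the count is 1 or 0.\<close>

lemma simple_minor_refl: "H \<preceq> H"
proof -
  have "{E' \<in> hedges H. id ` E' = E} = (if E \<in> hedges H then {E} else {})" for E
    by auto
  then have "quotient_map id H H"
    by (simp add: quotient_map_def)
  then show ?thesis
    unfolding simple_minor_def by blast
qed

lemma quotient_map_comp:
  assumes H2: "is_hypergraph H2" and H3: "is_hypergraph H3"
    and g: "quotient_map g H2 H1" and h: "quotient_map h H3 H2"
  shows "quotient_map (g \<circ> h) H3 H1"
  unfolding quotient_map_def
proof (intro conjI allI impI)
  have h_verts: "h \<in> verts H3 \<rightarrow> verts H2" and g_verts: "g \<in> verts H2 \<rightarrow> verts H1"
    using g h by (auto simp: quotient_map_def)
  then show "g \<circ> h \<in> verts H3 \<rightarrow> verts H1"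
    by auto
  have fin2: "finite (verts H2)" and edges2: "hedges H2 \<subseteq> Pow (verts H2)"
    using H2 by (auto simp: is_hypergraph_def)
  have edges3: "hedges H3 \<subseteq> Pow (verts H3)" and fin3: "finite (hedges H3)"
    using H3 by (auto simp: is_hypergraph_def intro: finite_subset)
  fix E assume E: "E \<subseteq> verts H1"
  \<comment> \<open>\<open>A\<close> is not restricted to hyperedges of \<open>H2\<close>: the image
    under \<open>h\<close> of a hyperedge of \<open>H3\<close> may be a non-hyperedge, whose fibre
    then has even size.\<close>
  define A where "A = {F \<in> Pow (verts H2). g ` F = E}"
  define fibre where "fibre F = {E' \<in> hedges H3. h ` E' = F}" for F
  have finA: "finite A"
    using fin2 by (simp add: A_def)
  have "{E' \<in> hedges H3. (g \<circ> h) ` E' = E} = (\<Union>F\<in>A. fibre F)"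
    using edges3 h_verts by (fastforce simp: A_def fibre_def image_comp)
  then have "card {E' \<in> hedges H3. (g \<circ> h) ` E' = E} = (\<Sum>F\<in>A. card (fibre F))"
    using finA fin3 by (simp only:) (rule card_UN_disjoint, auto simp: fibre_def)
  moreover have "odd (\<Sum>F\<in>A. card (fibre F)) \<longleftrightarrow> odd (card {F \<in> A. odd (card (fibre F))})"
    using finA by (simp add: even_sum_iff)
  \<comment> \<open>The quotient property of \<open>h\<close> applies to every member of
    \<open>A\<close>; conversely, hyperedges of \<open>H2\<close> are subsets of its vertex
    set.\<close>
  moreover have "{F \<in> A. odd (card (fibre F))} = {F \<in> hedges H2. g ` F = E}"
    using h edges2 by (auto simp: quotient_map_def A_def fibre_def)
  ultimately show "E \<in> hedges H1 \<longleftrightarrow> odd (card {E' \<in> hedges H3. (g \<circ> h) ` E' = E})"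
    using g E by (simp add: quotient_map_def)
qed

lemma simple_minor_trans:
  assumes "is_hypergraph H2" "is_hypergraph H3" "H1 \<preceq> H2" "H2 \<preceq> H3"
  shows "H1 \<preceq> H3"
  using assms quotient_map_comp unfolding simple_minor_def by blast

text \<open>\<open>reflp_on\<close> and \<open>transp_on\<close> fix a single vertex type; the last
  conjunct extends transitivity to three possibly different vertex types.\<close>

theorem lemma9:
  shows "reflp_on {H :: 'a hypergraph. is_hypergraph H} (\<preceq>) \<and>
         transp_on {H :: 'a hypergraph. is_hypergraph H} (\<preceq>) \<and>
         (\<forall>(H1 :: 'a hypergraph) (H2 :: 'b hypergraph) (H3 :: 'c hypergraph).
            is_hypergraph H1 \<longrightarrow> is_hypergraph H2 \<longrightarrow> is_hypergraph H3 \<longrightarrow>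
            H1 \<preceq> H2 \<longrightarrow> H2 \<preceq> H3 \<longrightarrow> H1 \<preceq> H3)"
proof (intro conjI allI impI)
  show "reflp_on {H :: 'a hypergraph. is_hypergraph H} (\<preceq>)"
    by (simp add: reflp_on_def simple_minor_refl)
  show "transp_on {H :: 'a hypergraph. is_hypergraph H} (\<preceq>)"
    by (rule transp_onI) (auto intro: simple_minor_trans)
qed (rule simple_minor_trans)

end
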